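(* Let $\Omega$ be a locally compact topological space. Then $C_0(\Omega)$ is a hyper-Tauberian algebra.
   Context: $C_0(\Omega)$ is the commutative $C^*$-algebra (sup norm, pointwise operations) of continuous complex-valued functions on $\Omega$ vanishing at infinity. Let $A$ be a commutative regular semisimple Banach algebra with carrier space (character space) $\Phi_A$; elements of $A$ are regarded as functions on $\Phi_A$ via the Gelfand transform. The hull of a closed ideal $I$ of $A$ is $h(I)=\{t\in\Phi_A: a(t)=0 \text{ for all } a\in I\}$. For a Banach left (right) $A$-module $X$ and $x\in X$, let $\mathrm{Ann}_A(x)=\{a\in A: ax=0\ (xa=0)\}$, a closed ideal of $A$; the support of $x$ is $\mathrm{supp}\,x=h(\mathrm{Ann}_A(x))$. A linear operator $T\colon X\to Y$ between Banach left (right) $A$-modules is local if $\mathrm{supp}\,T(x)\subseteq\mathrm{supp}\,x$ for all $x\in X$. $A$ is hyper-Tauberian if every bounded local operator $T\colon A\to A^*$ is a multiplier, i.e. $T(ab)=aT(b)$ for all $a,b\in A$, where $A^*$ has its usual (symmetric) dual $A$-module structure. *)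

theory Defs
  imports "HOL-Analysis.Analysis" "HOL-Library.Function_Algebras"
begin

text \<open>
  A commutative complex Banach algebra (not necessarily unital) is given by a carrier \<open>A\<close> inside
  an ambient ring type, a complex scalar multiplication and a norm. Functionals on \<open>A\<close>
  (characters, elements of the dual) are functions on the ambient type that are \<open>0\<close> off \<open>A\<close>,
  so that they are determined by their values on \<open>A\<close>.
\<close>

locale comm_banach_algebra = vector_space scale
  for scale :: "complex \<Rightarrow> 'b::ring \<Rightarrow> 'b" +
  fixes A :: "'b set" and nrm :: "'b \<Rightarrow> real"
  assumes subspace_A: "subspace A"
    and mult_closed: "\<lbrakk>a \<in> A; b \<in> A\<rbrakk> \<Longrightarrow> a * b \<in> A"
    and mult_comm: "\<lbrakk>a \<in> A; b \<in> A\<rbrakk> \<Longrightarrow> a * b = b * a"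
    and scale_mult: "\<lbrakk>a \<in> A; b \<in> A\<rbrakk> \<Longrightarrow> scale c a * b = scale c (a * b)"
    and nrm_ge_0: "a \<in> A \<Longrightarrow> 0 \<le> nrm a"
    and nrm_eq_0_iff: "a \<in> A \<Longrightarrow> nrm a = 0 \<longleftrightarrow> a = 0"
    and nrm_scale: "a \<in> A \<Longrightarrow> nrm (scale c a) = cmod c * nrm a"
    and nrm_triangle: "\<lbrakk>a \<in> A; b \<in> A\<rbrakk> \<Longrightarrow> nrm (a + b) \<le> nrm a + nrm b"
    and nrm_mult: "\<lbrakk>a \<in> A; b \<in> A\<rbrakk> \<Longrightarrow> nrm (a * b) \<le> nrm a * nrm b"
    and complete_A: "\<lbrakk>\<And>n::nat. u n \<in> A; \<forall>e>0. \<exists>N. \<forall>m\<ge>N. \<forall>n\<ge>N. nrm (u m - u n) < e\<rbrakk>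
      \<Longrightarrow> \<exists>l\<in>A. (\<lambda>n. nrm (u n - l)) \<longlonglongrightarrow> 0"
begin

definition linear_functional :: "('b \<Rightarrow> complex) \<Rightarrow> bool" where
  "linear_functional \<phi> \<longleftrightarrow>
     (\<forall>a\<in>A. \<forall>b\<in>A. \<phi> (a + b) = \<phi> a + \<phi> b) \<and>
     (\<forall>c. \<forall>a\<in>A. \<phi> (scale c a) = c * \<phi> a) \<and>
     (\<forall>a. a \<notin> A \<longrightarrow> \<phi> a = 0)"

definition characters :: "('b \<Rightarrow> complex) set" where
  "characters = {\<theta>. linear_functional \<theta> \<and>
     (\<forall>a\<in>A. \<forall>b\<in>A. \<theta> (a * b) = \<theta> a * \<theta> b) \<and> (\<exists>a\<in>A. \<theta> a \<noteq> 0)}"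

text \<open>
  The topology on the function type is the topology of pointwise convergence, so its
  restriction to \<open>characters\<close> is the Gelfand topology.
\<close>

definition gelfand_topology :: "('b \<Rightarrow> complex) topology" where
  "gelfand_topology = subtopology euclidean characters"

definition semisimple :: bool where
  "semisimple \<longleftrightarrow> (\<forall>a\<in>A. (\<forall>\<theta>\<in>characters. \<theta> a = 0) \<longrightarrow> a = 0)"

definition regular :: bool where
  "regular \<longleftrightarrow> (\<forall>E. closedin gelfand_topology E \<longrightarrow>
     (\<forall>\<theta>\<in>characters - E. \<exists>a\<in>A. \<theta> a = 1 \<and> (\<forall>\<psi>\<in>E. \<psi> a = 0)))"

definition ideal_hull :: "'b set \<Rightarrow> ('b \<Rightarrow> complex) set" where
  "ideal_hull I = {\<theta> \<in> characters. \<forall>a\<in>I. \<theta> a = 0}"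

text \<open>Below, \<open>act\<close> is the action of \<open>A\<close> on the module to which \<open>x\<close> belongs.\<close>

definition Ann :: "('b \<Rightarrow> 'x \<Rightarrow> 'x::zero) \<Rightarrow> 'x \<Rightarrow> 'b set" where
  "Ann act x = {a \<in> A. act a x = 0}"

definition supp :: "('b \<Rightarrow> 'x \<Rightarrow> 'x::zero) \<Rightarrow> 'x \<Rightarrow> ('b \<Rightarrow> complex) set" where
  "supp act x = ideal_hull (Ann act x)"

definition local_map ::
  "'x set \<Rightarrow> ('b \<Rightarrow> 'x \<Rightarrow> 'x::zero) \<Rightarrow> ('b \<Rightarrow> 'y \<Rightarrow> 'y::zero) \<Rightarrow> ('x \<Rightarrow> 'y) \<Rightarrow> bool" where
  "local_map M actM actN T \<longleftrightarrow> (\<forall>x\<in>M. supp actN (T x) \<subseteq> supp actM x)"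

definition dual :: "('b \<Rightarrow> complex) set" where
  "dual = {\<phi>. linear_functional \<phi> \<and> (\<exists>K. \<forall>a\<in>A. cmod (\<phi> a) \<le> K * nrm a)}"

definition dual_norm :: "('b \<Rightarrow> complex) \<Rightarrow> real" where
  "dual_norm \<phi> = (SUP a\<in>{a \<in> A. nrm a \<le> 1}. cmod (\<phi> a))"

text \<open>Since \<open>A\<close> is commutative, the left and right dual actions coincide.\<close>

definition dual_act :: "'b \<Rightarrow> ('b \<Rightarrow> complex) \<Rightarrow> 'b \<Rightarrow> complex" where
  "dual_act a \<phi> = (\<lambda>b. if b \<in> A then \<phi> (b * a) else 0)"

definition bounded_operator_to_dual :: "('b \<Rightarrow> 'b \<Rightarrow> complex) \<Rightarrow> bool" where
  "bounded_operator_to_dual T \<longleftrightarrow>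
     (\<forall>a\<in>A. T a \<in> dual) \<and>
     (\<forall>a\<in>A. \<forall>b\<in>A. T (a + b) = T a + T b) \<and>
     (\<forall>c. \<forall>a\<in>A. T (scale c a) = (\<lambda>b. c * T a b)) \<and>
     (\<exists>K. \<forall>a\<in>A. dual_norm (T a) \<le> K * nrm a)"

definition multiplier_to_dual :: "('b \<Rightarrow> 'b \<Rightarrow> complex) \<Rightarrow> bool" where
  "multiplier_to_dual T \<longleftrightarrow> (\<forall>a\<in>A. \<forall>b\<in>A. T (a * b) = dual_act a (T b))"

end

locale hyper_Tauberian = comm_banach_algebra +
  assumes semisimple: semisimple
    and regular: regular
    and local_imp_multiplier:
      "\<lbrakk>bounded_operator_to_dual T; local_map A (*) dual_act T\<rbrakk> \<Longrightarrow> multiplier_to_dual T"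

text \<open>
  Functions on the space \<open>X\<close> are extended by \<open>0\<close> off \<open>topspace X\<close>. The sum and product on the
  function type are the pointwise ones, and the supremum over the whole type in \<open>C0_norm\<close> is the
  supremum over \<open>topspace X\<close> (and \<open>0\<close> if that is empty).
\<close>

definition C0 :: "'a topology \<Rightarrow> ('a \<Rightarrow> complex) set" where
  "C0 X = {f. continuous_map X euclidean f \<and>
     (\<forall>e>0. compactin X {x \<in> topspace X. e \<le> cmod (f x)}) \<and>
     (\<forall>x. x \<notin> topspace X \<longrightarrow> f x = 0)}"

definition C0_scale :: "complex \<Rightarrow> ('a \<Rightarrow> complex) \<Rightarrow> 'a \<Rightarrow> complex" where
  "C0_scale c f = (\<lambda>x. c * f x)"

definition C0_norm :: "('a \<Rightarrow> complex) \<Rightarrow> real" where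
  "C0_norm f = (SUP x. cmod (f x))"

end

(* Let T : A -> A* be bounded and local, where A = C_0(X), and put B(a, b) = <T a, b>. A function in
   C_0(X) that vanishes on the hull of an ideal is a uniform limit of elements of the ideal, so
   locality gives B(a, b) = 0 whenever a b = 0.  For a real function y with 0 <= y <= n write
   y = p_1 + ... + p_n with ramps p_k = max 0 (min 1 (y + 1 - k)).  Since p_{k+1} (1 - p_k) = 0, each
   B(p_k b, (1 - p_k) c) reduces to B(q_k b, q_{k-1} c) with q_k = p_k - p_{k+1}, and averaging
   over signs bounds the sum of these terms by |B| |b| |c|, whatever n is.  Hence the difference
   B(y b, c) - B(b, y c) is bounded independently of y, and scaling y shows that it is 0.
   The same approximation by ideals identifies the characters with the nonzero point evaluations,
   even if X is not Hausdorff. *)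

theory Submission imports Defs begin

section \<open>The algebra of continuous functions vanishing at infinity\<close>

lemma continuous_map_mult_algebra:
  fixes f g :: "'a \<Rightarrow> 'b::real_normed_algebra"
  shows "continuous_map X euclidean f \<Longrightarrow> continuous_map X euclidean g
    \<Longrightarrow> continuous_map X euclidean (\<lambda>x. f x * g x)"
  by (simp add: continuous_map_atin tendsto_mult)

lemma continuous_map_continuous_on_compose:
  assumes "continuous_map X euclidean f" "continuous_on S g" "\<And>x. x \<in> topspace X \<Longrightarrow> f x \<in> S"
  shows "continuous_map X euclidean (\<lambda>x. g (f x))"
proof -
  have "continuous_map X (top_of_set S) f"
    using assms by (auto simp: continuous_map_in_subtopology)
  moreover have "continuous_map (top_of_set S) euclidean g"
    using assms by simp
  ultimately have "continuous_map X euclidean (g \<circ> f)"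
    by (rule continuous_map_compose)
  then show ?thesis
    by (simp add: o_def)
qed

lemma C0_continuous: "f \<in> C0 X \<Longrightarrow> continuous_map X euclidean f"
  by (simp add: C0_def)

lemma C0_outside: "f \<in> C0 X \<Longrightarrow> x \<notin> topspace X \<Longrightarrow> f x = 0"
  by (simp add: C0_def)

lemma C0_compactin: "f \<in> C0 X \<Longrightarrow> e > 0 \<Longrightarrow> compactin X {x \<in> topspace X. e \<le> cmod (f x)}"
  by (simp add: C0_def)

text \<open>The set where \<open>f\<close> is at least \<open>e\<close> in modulus is closed, being
  a preimage, and a closed subset of a compact set is compact. So a compact superset suffices in all
  later membership proofs.\<close>

lemma C0_I_dominated:
  assumes "continuous_map X euclidean f" "\<And>x. x \<notin> topspace X \<Longrightarrow> f x = 0"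
    and "\<And>e. e > 0 \<Longrightarrow> \<exists>K. compactin X K \<and> {x \<in> topspace X. e \<le> cmod (f x)} \<subseteq> K"
  shows "f \<in> C0 X"
proof -
  have "compactin X {x \<in> topspace X. e \<le> cmod (f x)}" if e: "e > 0" for e
  proof -
    obtain K where "compactin X K" "{x \<in> topspace X. e \<le> cmod (f x)} \<subseteq> K"
      using assms(3)[OF e] by blast
    moreover have "closedin X {x \<in> topspace X. cmod (f x) \<in> {e..}}"
      using continuous_map_norm[OF assms(1)]
      by (intro closedin_continuous_map_preimage[where Y = euclidean]) auto
    ultimately show ?thesis
      using closed_compactin by simp
  qed
  then show ?thesis
    using assms by (simp add: C0_def)
qed

text \<open>The set where \<open>f\<close> has modulus at least 1 is compact, so its image is
  bounded; elsewhere 1 is a bound.\<close>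

lemma C0_bounded:
  assumes "f \<in> C0 X"
  obtains M where "M > 0" "\<And>x. cmod (f x) \<le> M"
proof -
  let ?K = "{x \<in> topspace X. 1 \<le> cmod (f x)}"
  have "compactin euclidean (f ` ?K)"
    using image_compactin C0_compactin C0_continuous assms zero_less_one by blast
  then have "bounded (f ` ?K)"
    by (simp add: compact_imp_bounded)
  then obtain M where "\<And>x. x \<in> ?K \<Longrightarrow> cmod (f x) \<le> M"
    unfolding bounded_iff by blast
  then have "cmod (f x) \<le> max 1 M" for x
    using C0_outside[OF assms] by (cases "x \<in> topspace X"; cases "1 \<le> cmod (f x)") (auto simp: le_max_iff_disj)
  then show ?thesis
    using that[of "max 1 M"] by simp
qed

lemma C0_norm_upper:
  assumes "f \<in> C0 X"
  shows "cmod (f x) \<le> C0_norm f"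
proof -
  obtain M where "\<And>x. cmod (f x) \<le> M"
    using C0_bounded[OF assms] by blast
  then show ?thesis
    unfolding C0_norm_def by (intro cSUP_upper bdd_aboveI2) auto
qed

lemma C0_norm_least: "(\<And>x. cmod (f x) \<le> M) \<Longrightarrow> C0_norm f \<le> M"
  unfolding C0_norm_def by (rule cSUP_least) auto

lemma C0_norm_nonneg: "f \<in> C0 X \<Longrightarrow> 0 \<le> C0_norm f"
  using C0_norm_upper norm_ge_zero by (rule order_trans[rotated])

lemma C0_mult_bounded:
  assumes "f \<in> C0 X" "continuous_map X euclidean g" "\<And>x. x \<in> topspace X \<Longrightarrow> cmod (g x) \<le> M"
  shows "(\<lambda>x. g x * f x) \<in> C0 X"
proof (rule C0_I_dominated)
  show "continuous_map X euclidean (\<lambda>x. g x * f x)"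
    using assms C0_continuous continuous_map_mult_algebra by blast
  show "g x * f x = 0" if "x \<notin> topspace X" for x
    using C0_outside[OF assms(1) that] by simp
next
  fix e :: real
  assume e: "e > 0"
  \<comment> \<open>The maximum with 1 makes the divisor in \<open>e / M'\<close> positive.\<close>
  define M' where "M' = max M 1"
  have "e / M' \<le> cmod (f x)" if "x \<in> topspace X" "e \<le> cmod (g x * f x)" for x
  proof -
    have "cmod (g x * f x) \<le> M' * cmod (f x)"
      using assms(3)[OF that(1)] by (auto simp: norm_mult M'_def intro!: mult_right_mono)
    then show ?thesis
      using that(2) by (simp add: M'_def field_simps)
  qed
  then show "\<exists>K. compactin X K \<and> {x \<in> topspace X. e \<le> cmod (g x * f x)} \<subseteq> K"
    using C0_compactin[OF assms(1), of "e / M'"] e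
    by (intro exI[of _ "{x \<in> topspace X. e / M' \<le> cmod (f x)}"]) (auto simp: M'_def)
qed

lemma C0_zero: "0 \<in> C0 X"
  by (rule C0_I_dominated) (auto simp: zero_fun_def intro!: exI[of _ "{}"])

lemma C0_add:
  assumes "f \<in> C0 X" "g \<in> C0 X"
  shows "f + g \<in> C0 X"
proof (rule C0_I_dominated)
  show "continuous_map X euclidean (f + g)"
    using assms by (auto simp: plus_fun_def C0_continuous intro: continuous_map_add)
  show "(f + g) x = 0" if "x \<notin> topspace X" for x
    using assms that by (simp add: C0_outside)
next
  fix e :: real
  assume "e > 0"
  let ?L = "\<lambda>h. {x \<in> topspace X. e / 2 \<le> cmod (h x)}"
  have "compactin X (?L f \<union> ?L g)"
    using \<open>e > 0\<close> assms by (intro compactin_Un C0_compactin) auto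
  moreover have "e / 2 \<le> cmod (f x) \<or> e / 2 \<le> cmod (g x)" if "e \<le> cmod (f x + g x)" for x
    using that norm_triangle_ineq[of "f x" "g x"] by linarith
  then have "{x \<in> topspace X. e \<le> cmod ((f + g) x)} \<subseteq> ?L f \<union> ?L g"
    by auto
  ultimately show "\<exists>K. compactin X K \<and> {x \<in> topspace X. e \<le> cmod ((f + g) x)} \<subseteq> K"
    by blast
qed

lemma C0_scale_mem: "f \<in> C0 X \<Longrightarrow> C0_scale c f \<in> C0 X"
  unfolding C0_scale_def by (rule C0_mult_bounded[where M = "cmod c"]) auto

lemma C0_diff:
  assumes "f \<in> C0 X" "g \<in> C0 X"
  shows "f - g \<in> C0 X"
proof -
  have "f - g = f + C0_scale (-1) g"
    by (simp add: fun_eq_iff C0_scale_def)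
  then show ?thesis
    using assms C0_add C0_scale_mem by metis
qed

lemma C0_mult:
  assumes "f \<in> C0 X" "g \<in> C0 X"
  shows "f * g \<in> C0 X"
  unfolding times_fun_def
  by (rule C0_mult_bounded[where M = "C0_norm f"]) (use assms C0_continuous C0_norm_upper in auto)

lemma C0_cnj:
  assumes "f \<in> C0 X"
  shows "(\<lambda>x. cnj (f x)) \<in> C0 X"
proof (rule C0_I_dominated)
  show "continuous_map X euclidean (\<lambda>x. cnj (f x))"
    by (rule continuous_map_continuous_on_compose[where S = UNIV])
      (use assms C0_continuous in \<open>auto intro!: continuous_intros\<close>)
  show "\<exists>K. compactin X K \<and> {x \<in> topspace X. e \<le> cmod (cnj (f x))} \<subseteq> K" if "e > 0" for e
    using C0_compactin[OF assms that] by auto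
qed (simp add: C0_outside[OF assms])

lemma C0_sum: "(\<And>k. k \<in> F \<Longrightarrow> f k \<in> C0 X) \<Longrightarrow> sum f F \<in> C0 X"
  by (induction F rule: infinite_finite_induct) (auto intro: C0_add C0_zero)

lemma sum_fun_apply: "sum f F x = (\<Sum>k\<in>F. f k x)"
  by (induction F rule: infinite_finite_induct) auto

text \<open>A Cauchy sequence for the sup norm converges pointwise, and letting one index tend to
  infinity in the Cauchy estimate makes the convergence uniform; continuity and vanishing at
  infinity pass to the limit.\<close>

lemma C0_complete:
  assumes u: "\<And>n::nat. u n \<in> C0 X"
    and cauchy: "\<forall>e>0. \<exists>N. \<forall>m\<ge>N. \<forall>n\<ge>N. C0_norm (u m - u n) < e"
  shows "\<exists>l\<in>C0 X. (\<lambda>n. C0_norm (u n - l)) \<longlonglongrightarrow> 0"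
proof -
  have cauchy': "\<exists>N. \<forall>m\<ge>N. \<forall>n\<ge>N. \<forall>x. cmod (u m x - u n x) < e" if "e > 0" for e
  proof -
    obtain N where N: "\<forall>m\<ge>N. \<forall>n\<ge>N. C0_norm (u m - u n) < e"
      using cauchy \<open>e > 0\<close> by blast
    have "cmod (u m x - u n x) \<le> C0_norm (u m - u n)" for m n x
      using C0_norm_upper[OF C0_diff[OF u u], of m n x] by simp
    then show ?thesis
      using N by (intro exI[of _ N]) (blast intro: le_less_trans)
  qed
  have "Cauchy (\<lambda>n. u n x)" for x
    unfolding Cauchy_def dist_norm using cauchy' by blast
  then have l: "(\<lambda>n. u n x) \<longlonglongrightarrow> lim (\<lambda>n. u n x)" for x
    by (simp add: Cauchy_convergent flip: convergent_LIMSEQ_iff)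
  define l where "l = (\<lambda>x. lim (\<lambda>n. u n x))"
  have l: "(\<lambda>n. u n x) \<longlonglongrightarrow> l x" for x
    using l by (simp add: l_def)
  have unif: "\<exists>N. \<forall>n\<ge>N. \<forall>x. cmod (u n x - l x) \<le> e" if "e > 0" for e
  proof -
    obtain N where N: "\<forall>m\<ge>N. \<forall>n\<ge>N. \<forall>x. cmod (u m x - u n x) < e"
      using cauchy'[OF \<open>e > 0\<close>] by blast
    have "cmod (u n x - l x) \<le> e" if "n \<ge> N" for n x
    proof (rule Lim_bounded[where M = N])
      show "(\<lambda>m. cmod (u n x - u m x)) \<longlonglongrightarrow> cmod (u n x - l x)"
        by (intro tendsto_intros l)
    qed (use N that in \<open>auto intro: less_imp_le\<close>)
    then show ?thesis by blast
  qed
  have "l \<in> C0 X"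
  proof (rule C0_I_dominated)
    have "continuous_map X Met_TC.mtopology l"
    proof (rule Met_TC.continuous_map_uniform_limit[where F = sequentially and f = u])
      show "\<forall>\<^sub>F n in sequentially. continuous_map X Met_TC.mtopology (u n)"
        using u by (simp add: C0_continuous)
      show "\<forall>\<^sub>F n in sequentially. \<forall>x\<in>topspace X. l x \<in> UNIV \<and> dist (u n x) (l x) < e"
        if "e > 0" for e
      proof -
        obtain N where N: "\<forall>n\<ge>N. \<forall>x. cmod (u n x - l x) \<le> e / 2"
          using unif[of "e / 2"] \<open>e > 0\<close> by auto
        have "cmod (u n x - l x) < e" if "n \<ge> N" for n x
          using N[rule_format, OF that, of x] \<open>e > 0\<close> by simp
        then show ?thesis
          unfolding eventually_sequentially dist_norm by blast
      qed
    qed auto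
    then show "continuous_map X euclidean l"
      by simp
    show "l x = 0" if "x \<notin> topspace X" for x
      using l[of x] C0_outside[OF u that] by (simp add: LIMSEQ_const_iff)
    fix e :: real
    assume "e > 0"
    \<comment> \<open>One term within \<open>e / 2\<close> of the limit controls it at infinity:
      where \<open>l\<close> has modulus at least \<open>e\<close>, that term has modulus at least
      \<open>e / 2\<close>.\<close>
    then obtain n where n: "\<And>x. cmod (u n x - l x) \<le> e / 2"
      using unif[of "e / 2"] by auto
    have "e / 2 \<le> cmod (u n x)" if "e \<le> cmod (l x)" for x
      using n[of x] that norm_triangle_sub[of "l x" "u n x"] by (simp add: norm_minus_commute)
    then show "\<exists>K. compactin X K \<and> {x \<in> topspace X. e \<le> cmod (l x)} \<subseteq> K"
      using C0_compactin[OF u[of n], of "e / 2"] \<open>e > 0\<close>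
      by (intro exI[of _ "{x \<in> topspace X. e / 2 \<le> cmod (u n x)}"]) auto
  qed
  moreover have "(\<lambda>n. C0_norm (u n - l)) \<longlonglongrightarrow> 0"
  proof (rule LIMSEQ_I)
    fix e :: real
    assume "e > 0"
    then obtain N where N: "\<forall>n\<ge>N. \<forall>x. cmod (u n x - l x) \<le> e / 2"
      using unif[of "e / 2"] by auto
    have "norm (C0_norm (u n - l) - 0) < e" if "n \<ge> N" for n
    proof -
      have "C0_norm (u n - l) \<le> e / 2"
        using N that by (intro C0_norm_least) auto
      moreover have "0 \<le> C0_norm (u n - l)"
        using C0_norm_nonneg[OF C0_diff[OF u \<open>l \<in> C0 X\<close>]] .
      ultimately show ?thesis
        using \<open>e > 0\<close> by simp
    qed
    then show "\<exists>N. \<forall>n\<ge>N. norm (C0_norm (u n - l) - 0) < e"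
      by blast
  qed
  ultimately show ?thesis by blast
qed

lemma C0_norm_scale:
  assumes "f \<in> C0 X"
  shows "C0_norm (C0_scale c f) = cmod c * C0_norm f"
proof (rule antisym)
  show le: "C0_norm (C0_scale c f) \<le> cmod c * C0_norm f"
    by (rule C0_norm_least) (use C0_norm_upper[OF assms] in \<open>simp add: C0_scale_def norm_mult mult_left_mono\<close>)
  show "cmod c * C0_norm f \<le> C0_norm (C0_scale c f)"
  proof (cases "c = 0")
    case True
    then show ?thesis
      using C0_norm_nonneg[OF C0_scale_mem[OF assms]] by simp
  next
    case False
    have "C0_norm f \<le> C0_norm (C0_scale c f) / cmod c"
      by (rule C0_norm_least)
        (use C0_norm_upper[OF C0_scale_mem[OF assms, of c]] False
          in \<open>simp add: C0_scale_def norm_mult field_simps\<close>)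
    then show ?thesis
      using False by (simp add: field_simps)
  qed
qed

lemma C0_comm_banach_algebra: "comm_banach_algebra C0_scale (C0 X) C0_norm"
proof -
  interpret vector_space "C0_scale :: complex \<Rightarrow> ('a \<Rightarrow> complex) \<Rightarrow> 'a \<Rightarrow> complex"
    by unfold_locales (auto simp: C0_scale_def fun_eq_iff algebra_simps)
  show ?thesis
  proof
    show "subspace (C0 X)"
      by (auto simp: subspace_def C0_zero C0_add C0_scale_mem)
    show "a * b = b * a" for a b :: "'a \<Rightarrow> complex"
      by (rule mult.commute)
    show "C0_scale c a * b = C0_scale c (a * b)" for c and a b :: "'a \<Rightarrow> complex"
      by (simp add: C0_scale_def fun_eq_iff)
    show "C0_norm a = 0 \<longleftrightarrow> a = 0" if "a \<in> C0 X" for a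
    proof
      assume "C0_norm a = 0"
      then show "a = 0"
        using C0_norm_upper[OF that] by (simp add: fun_eq_iff)
    next
      assume "a = 0"
      then show "C0_norm a = 0"
        by (simp add: C0_norm_def)
    qed
    show "C0_norm (a + b) \<le> C0_norm a + C0_norm b" if "a \<in> C0 X" "b \<in> C0 X" for a b
    proof (rule C0_norm_least)
      show "cmod ((a + b) x) \<le> C0_norm a + C0_norm b" for x
        using norm_triangle_ineq[of "a x" "b x"] C0_norm_upper[OF that(1), of x]
          C0_norm_upper[OF that(2), of x] by simp
    qed
    show "C0_norm (a * b) \<le> C0_norm a * C0_norm b" if "a \<in> C0 X" "b \<in> C0 X" for a b
    proof (rule C0_norm_least)
      show "cmod ((a * b) x) \<le> C0_norm a * C0_norm b" for x
        using mult_mono[OF C0_norm_upper[OF that(1), of x] C0_norm_upper[OF that(2), of x]]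
          C0_norm_nonneg[OF that(1)] by (simp add: norm_mult)
    qed
  qed (fact C0_mult C0_norm_nonneg C0_norm_scale C0_complete)+
qed

section \<open>Ideals, characters and the Gelfand topology\<close>

text \<open>
  The functions in \<open>J\<close> below are the nonnegative elements of the ideal. Rescaling makes them exceed
  \<open>1\<close> near a given point, so a finite sum \<open>f\<close> of them is at least \<open>1\<close> on the compact set where \<open>b\<close>
  is not small, and \<open>b * f / (f + d)\<close> approximates \<open>b\<close>.
\<close>

lemma C0_ideal_approx:
  assumes I: "I \<subseteq> C0 X" "0 \<in> I" "\<And>f g. f \<in> I \<Longrightarrow> g \<in> I \<Longrightarrow> f + g \<in> I"
      "\<And>c f. c \<in> C0 X \<Longrightarrow> f \<in> I \<Longrightarrow> c * f \<in> I"
    and b: "b \<in> C0 X"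
    and hull: "\<And>x. b x \<noteq> 0 \<Longrightarrow> \<exists>f\<in>I. f x \<noteq> 0"
    and e: "e > 0"
  obtains c f where "c \<in> C0 X" "f \<in> I" "\<And>x. cmod (b x - c x * f x) < e"
proof -
  define J where "J = {f \<in> I. \<forall>x. Im (f x) = 0 \<and> 0 \<le> Re (f x)}"
  define K where "K = {x \<in> topspace X. e / 2 \<le> cmod (b x)}"
  have J_sum: "sum (\<lambda>f. f) F \<in> J" if "finite F" "F \<subseteq> J" for F
    using that by (induction F rule: finite_induct) (auto simp: J_def I)
  have J_point: "\<exists>f\<in>J. 1 < Re (f x)" if "b x \<noteq> 0" for x
  proof -
    obtain f where f: "f \<in> I" "f x \<noteq> 0"
      using hull \<open>b x \<noteq> 0\<close> by blast
    define m where "m = 2 / (cmod (f x))\<^sup>2"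
    define c where "c = C0_scale (complex_of_real m) (\<lambda>y. cnj (f y))"
    have "c \<in> C0 X"
      using f I by (auto simp: c_def intro!: C0_scale_mem C0_cnj)
    moreover have "(c * f) y = complex_of_real (m * (cmod (f y))\<^sup>2)" for y
      using complex_norm_square[of "f y"] by (simp add: c_def C0_scale_def mult.commute)
    ultimately show ?thesis
      using f I by (intro bexI[of _ "c * f"]) (auto simp: J_def m_def)
  qed
  define \<U> where "\<U> = (\<lambda>f. {x \<in> topspace X. Re (f x) \<in> {1<..}}) ` J"
  have open_U: "openin X U" if U: "U \<in> \<U>" for U
  proof -
    obtain f where f: "f \<in> J" "U = {x \<in> topspace X. Re (f x) \<in> {1<..}}"
      using U unfolding \<U>_def by blast
    have "f \<in> C0 X"
      using f I by (auto simp: J_def)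
    from C0_continuous[OF this] have "continuous_map X euclidean (\<lambda>x. Re (f x))"
      by (rule continuous_map_continuous_on_compose[where S = UNIV and f = f])
        (auto intro!: continuous_intros)
    then show ?thesis
      unfolding f(2) by (rule openin_continuous_map_preimage) simp
  qed
  have K_cover: "K \<subseteq> \<Union>\<U>"
  proof
    fix x
    assume "x \<in> K"
    then have "b x \<noteq> 0" "x \<in> topspace X"
      using e by (auto simp: K_def)
    then show "x \<in> \<Union>\<U>"
      using J_point[of x] by (auto simp: \<U>_def)
  qed
  have "compactin X K"
    unfolding K_def using e by (intro C0_compactin[OF b]) simp
  from compactinD[OF this open_U K_cover]
  obtain \<F> where \<F>: "finite \<F>" "\<F> \<subseteq> \<U>" "K \<subseteq> \<Union>\<F>"
    by blast
  from finite_subset_image[OF \<F>(1) \<F>(2)[unfolded \<U>_def]]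
  obtain F where F: "F \<subseteq> J" "finite F"
      and "\<F> = (\<lambda>f. {x \<in> topspace X. Re (f x) \<in> {1<..}}) ` F"
    by blast
  with \<F>(3) have cover: "K \<subseteq> \<Union>((\<lambda>f. {x \<in> topspace X. Re (f x) \<in> {1<..}}) ` F)"
    by simp
  define f where "f = sum (\<lambda>f. f) F"
  have fJ: "f \<in> J"
    using J_sum F by (simp add: f_def)
  define r where "r x = Re (f x)" for x
  have f_r: "f x = complex_of_real (r x)" and r_nonneg: "0 \<le> r x" for x
    using fJ by (auto simp: J_def r_def complex_eq_iff)
  have r_ge: "1 \<le> r x" if x: "x \<in> K" for x
  proof -
    obtain g where g: "g \<in> F" "1 < Re (g x)"
      using cover x by auto
    have "Re (g x) \<le> (\<Sum>h\<in>F. Re (h x))"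
      using F g by (intro member_le_sum) (auto simp: J_def)
    then show ?thesis
      using g by (simp add: r_def f_def sum_fun_apply)
  qed
  obtain M where M: "M > 0" "\<And>x. cmod (b x) \<le> M"
    using C0_bounded[OF b] by blast
  \<comment> \<open>On \<open>K\<close> the error is \<open>d / (r x + d) * cmod (b x)\<close> with
    \<open>1 \<le> r x\<close>, hence at most \<open>d * M = e / 2\<close>. Off \<open>K\<close> the
    factor is at most 1 and \<open>b\<close> itself is below \<open>e / 2\<close>.\<close>
  define d where "d = e / (2 * M)"
  have d: "d > 0"
    using e M by (simp add: d_def)
  \<comment> \<open>The real part of \<open>f\<close> is already nonnegative; \<open>max 0\<close>
    makes the reciprocal a continuous function on the whole complex plane, so that it can be
    composed with \<open>f\<close>.\<close>
  define c where "c = (\<lambda>x. complex_of_real (1 / (max 0 (Re (f x)) + d)) * b x)"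
  have "c \<in> C0 X"
    unfolding c_def
  proof (rule C0_mult_bounded[OF b, where M = "1 / d"])
    show "continuous_map X euclidean (\<lambda>x. complex_of_real (1 / (max 0 (Re (f x)) + d)))"
    proof (rule continuous_map_continuous_on_compose[where S = UNIV and f = f])
      show "continuous_map X euclidean f"
        using fJ I by (auto simp: J_def intro: C0_continuous)
      have "max 0 (Re z) + d \<noteq> 0" for z
        using d by (simp add: max_def)
      then show "continuous_on UNIV (\<lambda>z. complex_of_real (1 / (max 0 (Re z) + d)))"
        by (intro continuous_intros) auto
    qed simp
    show "cmod (complex_of_real (1 / (max 0 (Re (f x)) + d))) \<le> 1 / d" for x
      using d unfolding norm_of_real by (simp add: divide_simps)
  qed
  moreover have "cmod (b x - c x * f x) < e" for x
  proof -
    have pos: "r x + d > 0"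
      using r_nonneg[of x] d by simp
    have "c x * f x = complex_of_real (r x / (r x + d)) * b x"
      using r_nonneg[of x] by (simp add: c_def f_r)
    then have "b x - c x * f x = complex_of_real (1 - r x / (r x + d)) * b x"
      by (simp add: algebra_simps)
    also have "1 - r x / (r x + d) = d / (r x + d)"
      using pos by (simp add: field_simps)
    finally have eq: "cmod (b x - c x * f x) = d / (r x + d) * cmod (b x)"
      using pos d by (simp add: norm_mult del: of_real_divide of_real_add)
    show ?thesis
    proof (cases "x \<in> K")
      case True
      have "d / (r x + d) \<le> d"
        using r_ge[OF True] d divide_left_mono[of 1 "r x + d" d] by simp
      then have "d / (r x + d) * cmod (b x) \<le> d * M"
        using M d by (intro mult_mono) auto
      also have "d * M < e"
        using e M by (simp add: d_def)
      finally show ?thesis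
        using eq by simp
    next
      case False
      have "d / (r x + d) * cmod (b x) \<le> 1 * cmod (b x)"
        using r_nonneg[of x] d by (intro mult_right_mono) auto
      moreover have "cmod (b x) < e"
        using False C0_outside[OF b, of x] e by (auto simp: K_def)
      ultimately show ?thesis
        using eq by simp
    qed
  qed
  ultimately show ?thesis
    using that fJ by (auto simp: J_def)
qed

text \<open>The value 0 off \<open>C0 X\<close> follows the convention for functionals. At a point
  where every member of \<open>C0 X\<close> vanishes this is the zero functional, which is not a
  character.\<close>

definition C0_eval :: "'a topology \<Rightarrow> 'a \<Rightarrow> ('a \<Rightarrow> complex) \<Rightarrow> complex" where
  "C0_eval X x = (\<lambda>f. if f \<in> C0 X then f x else 0)"

context
  fixes X :: "'a topology"
begin

interpretation comm_banach_algebra C0_scale "C0 X" C0_norm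
  by (rule C0_comm_banach_algebra)

lemma C0_eval_character:
  assumes "f \<in> C0 X" "f x \<noteq> 0"
  shows "C0_eval X x \<in> characters"
  using assms
  by (auto simp: characters_def linear_functional_def C0_eval_def C0_add C0_scale_mem C0_mult)
    (auto simp: C0_scale_def)

text \<open>The kernel of \<open>\<theta>\<close> must vanish at some point where \<open>h\<close>,
  normalised by \<open>\<theta> h = 1\<close>, does not. Since the kernel and \<open>h\<close> span
  the algebra, \<open>\<theta>\<close> is then determined by evaluation at that point.\<close>

lemma character_imp_C0_eval:
  assumes \<theta>: "\<theta> \<in> characters"
  obtains x where "\<theta> = C0_eval X x" "x \<in> topspace X"
proof -
  have add: "\<theta> (f + g) = \<theta> f + \<theta> g" and mult: "\<theta> (f * g) = \<theta> f * \<theta> g"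
    and scale: "\<theta> (C0_scale c f) = c * \<theta> f" if "f \<in> C0 X" "g \<in> C0 X" for f g c
    using \<theta> that by (auto simp: characters_def linear_functional_def)
  have outside: "\<theta> f = 0" if "f \<notin> C0 X" for f
    using \<theta> that by (auto simp: characters_def linear_functional_def)
  have diff: "\<theta> (f - g) = \<theta> f - \<theta> g" if "f \<in> C0 X" "g \<in> C0 X" for f g
    using add[OF C0_diff[OF that] that(2)] by simp
  obtain h0 where h0: "h0 \<in> C0 X" "\<theta> h0 \<noteq> 0"
    using \<theta> by (auto simp: characters_def)
  define h where "h = C0_scale (1 / \<theta> h0) h0"
  have h: "h \<in> C0 X" "\<theta> h = 1"
    using h0 scale by (auto simp: h_def C0_scale_mem)
  define I where "I = {f \<in> C0 X. \<theta> f = 0}"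
  have "\<exists>x. h x \<noteq> 0 \<and> (\<forall>f\<in>I. f x = 0)"
  proof (rule ccontr)
    assume "\<not> ?thesis"
    then have hull: "\<exists>f\<in>I. f x \<noteq> 0" if "h x \<noteq> 0" for x
      using that by blast
    have zero: "0 \<in> I"
      using scale[OF C0_zero C0_zero, of 0] C0_zero by (simp add: I_def C0_scale_def zero_fun_def)
    \<comment> \<open>If there were no such point, \<open>h\<close> would be within 1/2 of a
      multiple of a kernel element. The difference \<open>a\<close> would have sup norm at most 1/2
      and yet \<open>\<theta> a = 1\<close>.\<close>
    obtain c f where cf: "c \<in> C0 X" "f \<in> I" "\<And>x. cmod (h x - c x * f x) < 1 / 2"
    proof (rule C0_ideal_approx[of I X h "1/2"])
      show "f + g \<in> I" if "f \<in> I" "g \<in> I" for f g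
        using that by (simp add: I_def C0_add add)
      show "c * f \<in> I" if "c \<in> C0 X" "f \<in> I" for c f
        using that by (simp add: I_def C0_mult mult)
    qed (use h hull zero in \<open>auto simp: I_def\<close>)
    define a where "a = h - c * f"
    have f: "f \<in> C0 X" "\<theta> f = 0"
      using cf by (auto simp: I_def)
    have a: "a \<in> C0 X" "\<theta> a = 1"
      using h cf f by (auto simp: a_def C0_diff C0_mult diff mult)
    have small: "cmod (a x) < 1 / 2" for x
      using cf by (simp add: a_def)
    have ne: "1 / 2 \<le> cmod (1 - a x)" for x
      using small[of x] norm_triangle_ineq2[of 1 "a x"] by simp
    \<comment> \<open>This is the quasi-inverse \<open>a / (1 - a)\<close>, a substitute for
      inverting \<open>1 - a\<close> in an algebra that may lack a unit. Applying
      \<open>\<theta>\<close> to \<open>g - a * g = a\<close> gives \<open>0 = 1\<close>.\<close>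
    define g where "g = (\<lambda>x. inverse (1 - a x) * a x)"
    have g: "g \<in> C0 X"
      unfolding g_def
    proof (rule C0_mult_bounded[OF a(1), where M = 2])
      show "continuous_map X euclidean (\<lambda>x. inverse (1 - a x))"
      proof (rule continuous_map_continuous_on_compose[where S = "- {1}" and f = a])
        show "a x \<in> - {1}" for x
          using ne[of x] by auto
        show "continuous_on (- {1}) (\<lambda>z::complex. inverse (1 - z))"
          by (intro continuous_intros) auto
      qed (use a C0_continuous in blast)
      show "cmod (inverse (1 - a x)) \<le> 2" for x
        using ne[of x] le_imp_inverse_le[OF ne[of x]] by (simp add: norm_inverse)
    qed
    have "g - a * g = a"
    proof
      fix x
      have "1 - a x \<noteq> 0"
        using ne[of x] by auto
      moreover have "(g - a * g) x = (1 - a x) * inverse (1 - a x) * a x"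
        by (simp add: g_def algebra_simps)
      ultimately show "(g - a * g) x = a x"
        by simp
    qed
    then have "\<theta> a = \<theta> g - \<theta> a * \<theta> g"
      using diff[OF g C0_mult[OF a(1) g]] mult[OF a(1) g] by simp
    then show False
      using a by simp
  qed
  then obtain x where x: "h x \<noteq> 0" "\<And>f. f \<in> I \<Longrightarrow> f x = 0"
    by blast
  have multiple: "f x = \<theta> f * h x" if f: "f \<in> C0 X" for f
  proof -
    have "f - C0_scale (\<theta> f) h \<in> I"
      using f h scale[OF h(1) h(1)] diff[OF f C0_scale_mem[OF h(1)]]
      by (simp add: I_def C0_diff C0_scale_mem)
    then show ?thesis
      using x(2) by (fastforce simp: C0_scale_def)
  qed
  \<comment> \<open>The formula \<open>multiple\<close> for \<open>h * h\<close> makes the nonzero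
    number \<open>h x\<close> idempotent.\<close>
  have "h x = 1"
    using multiple[OF C0_mult[OF h(1) h(1)]] mult[OF h(1) h(1)] h x by simp
  then have "\<theta> = C0_eval X x"
    using multiple outside by (auto simp: C0_eval_def fun_eq_iff)
  moreover have "x \<in> topspace X"
    using x(1) C0_outside[OF h(1), of x] by blast
  ultimately show ?thesis
    by (rule that)
qed

section \<open>Semisimplicity and regularity\<close>

lemma C0_semisimple: semisimple
  unfolding semisimple_def
proof (intro ballI impI ext)
  fix a x
  assume a: "a \<in> C0 X" "\<forall>\<theta>\<in>characters. \<theta> a = 0"
  show "a x = 0 x"
  proof (rule ccontr)
    assume "a x \<noteq> 0 x"
    then have "C0_eval X x a = 0"
      using C0_eval_character[OF a(1)] a(2) by simp
    then show False
      using a(1) \<open>a x \<noteq> 0 x\<close> by (simp add: C0_eval_def)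
  qed
qed

text \<open>Starting from \<open>h\<close>, each \<open>f\<close> in \<open>F\<close> contributes a
  tent function of its distance to \<open>f x\<close>. The members of \<open>F\<close> themselves
  thus do the work of Urysohn's lemma.\<close>

lemma C0_bump:
  assumes "finite F" "F \<subseteq> C0 X" "\<And>f. f \<in> F \<Longrightarrow> open (W f) \<and> f x \<in> W f"
    and "h \<in> C0 X" "h x = 1"
  obtains a where "a \<in> C0 X" "a x = 1" "\<And>y f. f \<in> F \<Longrightarrow> a y \<noteq> 0 \<Longrightarrow> f y \<in> W f"
proof -
  have "\<exists>a\<in>C0 X. a x = 1 \<and> (\<forall>f\<in>F. \<forall>y. a y \<noteq> 0 \<longrightarrow> f y \<in> W f)"
    using assms(1-3)
  proof (induction F rule: finite_induct)
    case empty
    then show ?case using assms by auto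
  next
    case (insert f F)
    then have "\<exists>a\<in>C0 X. a x = 1 \<and> (\<forall>f\<in>F. \<forall>y. a y \<noteq> 0 \<longrightarrow> f y \<in> W f)"
      by simp
    then obtain a where a: "a \<in> C0 X" "a x = 1" "\<forall>f\<in>F. \<forall>y. a y \<noteq> 0 \<longrightarrow> f y \<in> W f"
      by blast
    have "open (W f)" "f x \<in> W f"
      using insert.prems(2)[of f] by auto
    then obtain r where r: "r > 0" "ball (f x) r \<subseteq> W f"
      by (rule openE)
    define a' where "a' = (\<lambda>y. complex_of_real (max 0 (1 - dist (f x) (f y) / r)) * a y)"
    have "a' \<in> C0 X"
      unfolding a'_def
    proof (rule C0_mult_bounded[OF a(1), where M = 1])
      show "continuous_map X euclidean (\<lambda>y. complex_of_real (max 0 (1 - dist (f x) (f y) / r)))"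
        by (rule continuous_map_continuous_on_compose[where S = UNIV and f = f])
          (use insert.prems r in \<open>auto simp: C0_continuous intro!: continuous_intros\<close>)
    qed (use r in auto)
    moreover have "f y \<in> W f" if "a' y \<noteq> 0" for y
    proof -
      have "dist (f x) (f y) / r < 1"
        by (rule ccontr) (use that in \<open>simp add: a'_def\<close>)
      then show ?thesis
        using r by (auto simp: field_simps)
    qed
    ultimately show ?case
      using a by (intro bexI[of _ a']) (auto simp: a'_def)
  qed
  then show ?thesis
    using that by blast
qed

text \<open>A basic neighbourhood of \<open>\<theta>\<close> in the pointwise topology constrains
  only finitely many coordinates. A bump function for these can be nonzero only at points whose
  evaluations meet the same constraints.\<close>

lemma C0_regular: regular
  unfolding regular_def
proof (intro allI impI ballI)
  fix E \<theta>
  assume E: "closedin gelfand_topology E" and \<theta>: "\<theta> \<in> characters - E"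
  obtain D where D: "closed D" "E = D \<inter> characters"
    using E unfolding gelfand_topology_def closedin_subtopology by auto
  obtain x where x: "\<theta> = C0_eval X x" "x \<in> topspace X"
    using \<theta> character_imp_C0_eval by blast
  have oD: "openin (product_topology (\<lambda>_. euclidean) UNIV) (- D)"
    using D(1) by (metis open_Compl open_fun_def)
  have "\<theta> \<in> - D"
    using \<theta> D by auto
  from product_topology_open_contains_basis[OF oD this] obtain W where W: "\<theta> \<in> (\<Pi>\<^sub>E i\<in>UNIV. W i)" "\<And>i. openin euclidean (W i)"
      "finite {i. W i \<noteq> topspace euclidean}" "(\<Pi>\<^sub>E i\<in>UNIV. W i) \<subseteq> - D"
    by blast
  define F where "F = {f \<in> C0 X. W f \<noteq> UNIV}"
  have "finite F"
    using W(3) by (rule finite_subset[rotated]) (auto simp: F_def)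
  have \<theta>W: "\<theta> f \<in> W f" for f
    using W(1) by auto
  obtain h0 where h0: "h0 \<in> C0 X" "h0 x \<noteq> 0"
    using \<theta> x by (auto simp: characters_def C0_eval_def)
  obtain a where a: "a \<in> C0 X" "a x = 1" "\<And>y f. f \<in> F \<Longrightarrow> a y \<noteq> 0 \<Longrightarrow> f y \<in> W f"
  proof (rule C0_bump[of F W x "C0_scale (1 / h0 x) h0"])
    show "open (W f) \<and> f x \<in> W f" if "f \<in> F" for f
      using that W(2) \<theta>W[of f] x by (auto simp: F_def C0_eval_def)
  qed (use \<open>finite F\<close> h0 in \<open>auto simp: F_def C0_scale_mem\<close>, simp add: C0_scale_def)
  have "\<psi> a = 0" if \<psi>: "\<psi> \<in> E" for \<psi>
  proof (rule ccontr)
    assume nz: "\<psi> a \<noteq> 0"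
    obtain y where y: "\<psi> = C0_eval X y"
      using \<psi> D character_imp_C0_eval by blast
    have "\<psi> f \<in> W f" for f
      using \<theta>W[of f] a(3)[of f y] nz x y a(1) by (auto simp: F_def C0_eval_def split: if_splits)
    then show False
      using W(4) \<psi> D by auto
  qed
  then show "\<exists>a\<in>C0 X. \<theta> a = 1 \<and> (\<forall>\<psi>\<in>E. \<psi> a = 0)"
    using a x by (intro bexI[of _ a]) (auto simp: C0_eval_def)
qed

section \<open>Bounded local operators into the dual\<close>

text \<open>As \<open>b\<close> annihilates \<open>a\<close>, no point with
  \<open>b x \<noteq> 0\<close> lies in the support of \<open>a\<close>, nor, by locality, in that
  of \<open>T a\<close>. So the annihilator \<open>I\<close> of \<open>T a\<close> approximates
  \<open>b\<close> by products \<open>c * f\<close> with \<open>f\<close> in \<open>I\<close>, and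
  on these \<open>T a\<close> is 0.\<close>

lemma local_map_disjoint:
  assumes T: "bounded_operator_to_dual T" "local_map (C0 X) (*) dual_act T"
    and a: "a \<in> C0 X" and b: "b \<in> C0 X" and ab: "a * b = 0"
  shows "T a b = 0"
proof -
  define I where "I = Ann dual_act (T a)"
  have "T a \<in> dual"
    using T a by (auto simp: bounded_operator_to_dual_def)
  then have lin: "linear_functional (T a)"
    by (simp add: dual_def)
  obtain K0 where K0: "\<And>c. c \<in> C0 X \<Longrightarrow> cmod (T a c) \<le> K0 * C0_norm c"
    using \<open>T a \<in> dual\<close> by (auto simp: dual_def)
  \<comment> \<open>The maximum with 1 allows the tolerance \<open>e / K\<close>.\<close>
  define K where "K = max K0 1"
  have K: "cmod (T a c) \<le> K * C0_norm c" if "c \<in> C0 X" for c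
    using K0[OF that] mult_right_mono[of K0 K, OF _ C0_norm_nonneg[OF that]] by (simp add: K_def)
  have add: "T a (f + g) = T a f + T a g" if "f \<in> C0 X" "g \<in> C0 X" for f g
    using lin that by (auto simp: linear_functional_def)
  have "T a (C0_scale 0 0) = 0 * T a 0"
    using lin C0_zero unfolding linear_functional_def by blast
  then have zero: "T a 0 = 0"
    by (simp add: C0_scale_def zero_fun_def)
  have I_iff: "f \<in> I \<longleftrightarrow> f \<in> C0 X \<and> (\<forall>c\<in>C0 X. T a (c * f) = 0)" for f
    by (auto simp: I_def Ann_def dual_act_def fun_eq_iff)
  have hull: "\<exists>f\<in>I. f x \<noteq> 0" if bx: "b x \<noteq> 0" for x
  proof -
    have "b \<in> Ann (*) a"
      using b ab by (simp add: Ann_def mult.commute)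
    moreover have "C0_eval X x b \<noteq> 0"
      using bx b by (simp add: C0_eval_def)
    ultimately have "C0_eval X x \<notin> supp (*) a"
      by (auto simp: supp_def ideal_hull_def)
    then have "C0_eval X x \<notin> supp dual_act (T a)"
      using T(2) a by (auto simp: local_map_def)
    then show ?thesis
      using C0_eval_character[OF b bx]
      by (auto simp: supp_def ideal_hull_def I_def C0_eval_def split: if_splits)
  qed
  have "cmod (T a b) \<le> 0 + e" if e: "e > 0" for e
  proof -
    obtain c f where cf: "c \<in> C0 X" "f \<in> I" "\<And>x. cmod (b x - c x * f x) < e / K"
    proof (rule C0_ideal_approx[of I X b "e / K"])
      show "f + g \<in> I" if "f \<in> I" "g \<in> I" for f g
        using that by (auto simp: I_iff C0_add add C0_mult distrib_left)
      show "c * f \<in> I" if "c \<in> C0 X" "f \<in> I" for c f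
        using that by (auto simp: I_iff C0_mult simp flip: mult.assoc)
    qed (use b hull e zero C0_zero in \<open>auto simp: I_iff K_def\<close>)
    have *: "c * f \<in> C0 X" "T a (c * f) = 0"
      using cf by (auto simp: I_iff C0_mult)
    have d: "b - c * f \<in> C0 X"
      using b * by (simp add: C0_diff)
    have "T a b = T a (b - c * f)"
      using add[OF d *(1)] * by simp
    also have "cmod \<dots> \<le> K * C0_norm (b - c * f)"
      by (rule K[OF d])
    also have "\<dots> \<le> K * (e / K)"
      using cf(3) by (intro mult_left_mono C0_norm_least) (auto simp: K_def intro: less_imp_le)
    finally show ?thesis
      by (simp add: K_def)
  qed
  then have "cmod (T a b) \<le> 0"
    by (rule field_le_epsilon)
  then show ?thesis
    by simp
qed

text \<open>The operator bound is stated through \<open>dual_norm\<close>, a supremum over the unit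
  ball; normalising \<open>b\<close> turns it into an estimate for all pairs.\<close>

lemma bounded_operator_bilinear_bound:
  assumes T: "bounded_operator_to_dual T"
  obtains K where "K \<ge> 0"
    "\<And>a b. a \<in> C0 X \<Longrightarrow> b \<in> C0 X \<Longrightarrow> cmod (T a b) \<le> K * C0_norm a * C0_norm b"
proof -
  obtain K0 where K0: "\<And>a. a \<in> C0 X \<Longrightarrow> dual_norm (T a) \<le> K0 * C0_norm a"
    using T unfolding bounded_operator_to_dual_def by blast
  define K where "K = max K0 0"
  have "cmod (T a b) \<le> K * C0_norm a * C0_norm b" if a: "a \<in> C0 X" and b: "b \<in> C0 X" for a b
  proof -
    have "T a \<in> dual"
      using T a by (auto simp: bounded_operator_to_dual_def)
    then obtain L where L: "\<And>c. c \<in> C0 X \<Longrightarrow> cmod (T a c) \<le> L * C0_norm c"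
      by (auto simp: dual_def)
    have lin: "T a (C0_scale t b) = t * T a b" for t
      using \<open>T a \<in> dual\<close> b by (auto simp: dual_def linear_functional_def)
    show ?thesis
    \<comment> \<open>Such a \<open>b\<close> cannot be normalised, but the individual bound
      \<open>L\<close> for \<open>T a\<close> already gives \<open>T a b = 0\<close>.\<close>
    proof (cases "C0_norm b = 0")
      case True
      then show ?thesis
        using L[OF b] by simp
    next
      case False
      then have pos: "C0_norm b > 0"
        using C0_norm_nonneg[OF b] by simp
      define b' where "b' = C0_scale (complex_of_real (1 / C0_norm b)) b"
      have b': "b' \<in> C0 X" "C0_norm b' = 1"
        using b pos by (auto simp: b'_def C0_scale_mem C0_norm_scale[OF b] simp del: of_real_divide)
      \<comment> \<open>The supremum in \<open>dual_norm\<close> is an upper bound only once the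
        values are known to be bounded; membership of \<open>T a\<close> in the dual supplies
        this.\<close>
      have "cmod (T a c) \<le> \<bar>L\<bar>" if "c \<in> C0 X" "C0_norm c \<le> 1" for c
      proof -
        have "L * C0_norm c \<le> \<bar>L\<bar> * 1"
          using that C0_norm_nonneg[OF that(1)] by (intro mult_mono) auto
        then show ?thesis
          using L[OF that(1)] by simp
      qed
      then have "cmod (T a b') \<le> dual_norm (T a)"
        unfolding dual_norm_def using b' by (intro cSUP_upper bdd_aboveI2[where M = "\<bar>L\<bar>"]) auto
      also have "\<dots> \<le> K * C0_norm a"
        using K0[OF a] mult_right_mono[of K0 K, OF _ C0_norm_nonneg[OF a]] by (simp add: K_def)
      finally show ?thesis
        using pos by (simp add: b'_def lin norm_mult norm_divide field_simps)
    qed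
  qed
  then show ?thesis
    using that[of K] by (simp add: K_def)
qed

end

section \<open>Bilinear forms vanishing on orthogonal pairs\<close>

text \<open>To be used with \<open>B u v = T u v\<close>. The assumptions are symmetric in the two
  arguments, so every consequence also holds for the form with arguments exchanged.\<close>

locale C0_orthogonal_form =
  fixes X :: "'a topology" and B :: "('a \<Rightarrow> complex) \<Rightarrow> ('a \<Rightarrow> complex) \<Rightarrow> complex" and K :: real
  assumes add_left: "\<lbrakk>u \<in> C0 X; v \<in> C0 X; w \<in> C0 X\<rbrakk> \<Longrightarrow> B (u + v) w = B u w + B v w"
    and add_right: "\<lbrakk>u \<in> C0 X; v \<in> C0 X; w \<in> C0 X\<rbrakk> \<Longrightarrow> B w (u + v) = B w u + B w v"
    and scale_left: "\<lbrakk>u \<in> C0 X; w \<in> C0 X\<rbrakk> \<Longrightarrow> B (C0_scale c u) w = c * B u w"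
    and scale_right: "\<lbrakk>u \<in> C0 X; w \<in> C0 X\<rbrakk> \<Longrightarrow> B w (C0_scale c u) = c * B w u"
    and K_nonneg: "0 \<le> K"
    and bound: "\<lbrakk>u \<in> C0 X; v \<in> C0 X\<rbrakk> \<Longrightarrow> cmod (B u v) \<le> K * C0_norm u * C0_norm v"
    and orthogonal: "\<lbrakk>u \<in> C0 X; v \<in> C0 X; u * v = 0\<rbrakk> \<Longrightarrow> B u v = 0"
begin

lemma flip: "C0_orthogonal_form X (\<lambda>u v. B v u) K"
proof
  show "cmod (B v u) \<le> K * C0_norm u * C0_norm v" if "u \<in> C0 X" "v \<in> C0 X" for u v
    using bound[OF that(2,1)] by (simp add: ac_simps)
  show "B v u = 0" if "u \<in> C0 X" "v \<in> C0 X" "u * v = 0" for u v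
    using orthogonal[OF that(2,1)] that(3) by (simp add: mult.commute)
qed (fact add_left add_right scale_left scale_right K_nonneg)+

lemma diff_left: "\<lbrakk>u \<in> C0 X; v \<in> C0 X; w \<in> C0 X\<rbrakk> \<Longrightarrow> B (u - v) w = B u w - B v w"
  using add_left[OF C0_diff, of u v v w] by simp

lemma diff_right: "\<lbrakk>u \<in> C0 X; v \<in> C0 X; w \<in> C0 X\<rbrakk> \<Longrightarrow> B w (u - v) = B w u - B w v"
  using add_right[OF C0_diff, of u v v w] by simp

lemma sum_left: "\<lbrakk>\<And>k. k \<in> F \<Longrightarrow> u k \<in> C0 X; w \<in> C0 X\<rbrakk> \<Longrightarrow> B (sum u F) w = (\<Sum>k\<in>F. B (u k) w)"
proof (induction F rule: infinite_finite_induct)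
  case (insert k F)
  then have "B (sum u (insert k F)) w = B (u k) w + B (sum u F) w"
    unfolding sum.insert[OF insert.hyps] by (intro add_left C0_sum) auto
  also have "B (sum u F) w = (\<Sum>k\<in>F. B (u k) w)"
    using insert by simp
  also have "B (u k) w + \<dots> = (\<Sum>k\<in>insert k F. B (u k) w)"
    using insert.hyps by simp
  finally show ?case .
qed (use scale_left[OF C0_zero, of w 0] in \<open>simp_all add: C0_scale_def zero_fun_def\<close>)

lemma bound_pointwise:
  assumes "u \<in> C0 X" "v \<in> C0 X" "\<And>x. cmod (u x) \<le> P" "\<And>x. cmod (v x) \<le> Q"
  shows "cmod (B u v) \<le> K * P * Q"
proof -
  have "C0_norm u \<le> P" "C0_norm v \<le> Q"
    using assms by (auto intro: C0_norm_least)
  moreover have "0 \<le> C0_norm u" "0 \<le> C0_norm v"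
    using assms by (auto intro: C0_norm_nonneg)
  ultimately have "K * C0_norm u * C0_norm v \<le> K * P * Q"
    using K_nonneg by (intro mult_mono) auto
  then show ?thesis
    using bound[OF assms(1,2)] by simp
qed

text \<open>
  The diagonal sum is an average of the values \<open>B (\<Sum>k. \<epsilon> k * u k) (\<Sum>k. \<epsilon> k * v k)\<close> over all signs
  \<open>\<epsilon>\<close>; the induction averages over one sign at a time.
\<close>

lemma diagonal_sum_bound:
  fixes n :: nat
  assumes "U \<in> C0 X" "V \<in> C0 X" "\<And>k. k < n \<Longrightarrow> u k \<in> C0 X" "\<And>k. k < n \<Longrightarrow> v k \<in> C0 X"
    and "\<And>x. cmod (U x) + (\<Sum>k<n. cmod (u k x)) \<le> P"
    and "\<And>x. cmod (V x) + (\<Sum>k<n. cmod (v k x)) \<le> Q"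
  shows "cmod (B U V + (\<Sum>k<n. B (u k) (v k))) \<le> K * P * Q"
  using assms
proof (induction n arbitrary: U V)
  case 0
  then show ?case by (simp add: bound_pointwise)
next
  case (Suc n)
  define S where "S = (\<Sum>k<n. B (u k) (v k))"
  have mem: "u n \<in> C0 X" "v n \<in> C0 X"
    using Suc.prems by auto
  \<comment> \<open>The last terms are absorbed into \<open>U\<close> and \<open>V\<close> with
    either sign, and the triangle inequality preserves the pointwise bounds. This is the purpose of
    carrying \<open>U\<close> and \<open>V\<close> through the induction.\<close>
  have "cmod (U x + u n x) + (\<Sum>k<n. cmod (u k x)) \<le> P"
    "cmod (U x - u n x) + (\<Sum>k<n. cmod (u k x)) \<le> P"
    "cmod (V x + v n x) + (\<Sum>k<n. cmod (v k x)) \<le> Q"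
    "cmod (V x - v n x) + (\<Sum>k<n. cmod (v k x)) \<le> Q" for x
    using Suc.prems(5,6)[of x] norm_triangle_ineq[of "U x" "u n x"] norm_triangle_ineq4[of "U x" "u n x"]
      norm_triangle_ineq[of "V x" "v n x"] norm_triangle_ineq4[of "V x" "v n x"] by auto
  then have plus: "cmod (B (U + u n) (V + v n) + S) \<le> K * P * Q"
    and minus: "cmod (B (U - u n) (V - v n) + S) \<le> K * P * Q"
    unfolding S_def using Suc.prems mem by (auto intro!: Suc.IH C0_add C0_diff)
  have eq: "2 * (B U V + (B (u n) (v n) + S)) = (B (U + u n) (V + v n) + S) + (B (U - u n) (V - v n) + S)"
    using Suc.prems mem by (simp add: add_left add_right diff_left diff_right C0_add C0_diff algebra_simps)
  have "cmod (2 * (B U V + (B (u n) (v n) + S))) \<le> K * P * Q + K * P * Q"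
    unfolding eq by (rule norm_triangle_mono[OF plus minus])
  then have "cmod (B U V + (B (u n) (v n) + S)) \<le> K * P * Q"
    unfolding norm_mult by simp
  then show ?case
    by (simp add: S_def add.commute)
qed

end

section \<open>Slicing a real multiplier into ramps\<close>

definition real_mult :: "('a \<Rightarrow> real) \<Rightarrow> ('a \<Rightarrow> complex) \<Rightarrow> 'a \<Rightarrow> complex" where
  "real_mult p f = (\<lambda>x. complex_of_real (p x) * f x)"

lemma C0_real_mult:
  assumes "f \<in> C0 X" "continuous_map X euclidean p" "\<And>x. x \<in> topspace X \<Longrightarrow> \<bar>p x\<bar> \<le> M"
  shows "real_mult p f \<in> C0 X"
  unfolding real_mult_def
proof (rule C0_mult_bounded[OF assms(1), where M = M])
  show "continuous_map X euclidean (\<lambda>x. complex_of_real (p x))"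
    by (rule continuous_map_continuous_on_compose[where S = UNIV and f = p])
      (use assms in \<open>auto intro!: continuous_intros\<close>)
qed (use assms in simp)

text \<open>It climbs from 0 to 1 as \<open>y x\<close> runs from \<open>k - 1\<close> to
  \<open>k\<close>. For nonnegative \<open>y\<close> the ramp with index 0 is constantly 1, so the
  layers of \<open>y\<close> are those with index \<open>Suc k\<close>.\<close>

definition ramp :: "('a \<Rightarrow> real) \<Rightarrow> nat \<Rightarrow> 'a \<Rightarrow> real" where
  "ramp y k x = max 0 (min 1 (y x + 1 - real k))"

lemma ramp_bounds: "0 \<le> ramp y k x" "ramp y k x \<le> 1"
  by (auto simp: ramp_def)

lemma ramp_Suc_le: "ramp y (Suc k) x \<le> ramp y k x"
  by (auto simp: ramp_def)

text \<open>A ramp starts to climb only where its predecessor has reached 1. This is the source of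
  all orthogonal pairs below.\<close>

lemma ramp_Suc_cases: "ramp y (Suc k) x = 0 \<or> ramp y k x = 1"
  by (auto simp: ramp_def)

lemma continuous_map_ramp:
  "continuous_map X euclidean y \<Longrightarrow> continuous_map X euclidean (ramp y k)"
  unfolding ramp_def[abs_def]
  by (rule continuous_map_continuous_on_compose[where S = UNIV and f = y])
    (auto intro!: continuous_intros)

text \<open>The first \<open>m\<close> unit layers of \<open>y\<close> add up to
  \<open>min m y\<close>.\<close>

lemma sum_ramp:
  assumes "0 \<le> y x" "y x \<le> real n"
  shows "(\<Sum>k<n. ramp y (Suc k) x) = y x"
proof -
  have "(\<Sum>k<m. ramp y (Suc k) x) = min (real m) (y x)" for m
    using assms(1) by (induction m) (auto simp: ramp_def)
  then show ?thesis
    using assms(2) by simp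
qed

context C0_orthogonal_form
begin

text \<open>Orthogonality acts twice. It removes \<open>p (Suc (Suc k))\<close> from the first
  factor, leaving \<open>q (Suc k)\<close>; this lives where \<open>p k = 1\<close>, so that
  \<open>c\<close> may be replaced by \<open>p k\<close> times \<open>c\<close> in the second,
  leaving \<open>q k\<close>.\<close>

lemma ramp_strip:
  fixes y :: "'a \<Rightarrow> real"
  defines "p \<equiv> ramp y" and "q \<equiv> (\<lambda>k x. ramp y k x - ramp y (Suc k) x)"
  assumes y: "continuous_map X euclidean y" and b: "b \<in> C0 X" and c: "c \<in> C0 X"
  shows "B (real_mult (p (Suc k)) b) (c - real_mult (p (Suc k)) c)
    = B (real_mult (q (Suc k)) b) (real_mult (q k) c)"
proof -
  have p: "real_mult (p k) f \<in> C0 X" if "f \<in> C0 X" for k f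
    using that y ramp_bounds[of y k]
    by (intro C0_real_mult[where M = 1]) (auto simp: p_def intro: continuous_map_ramp)
  have q_eq: "real_mult (q k) f = real_mult (p k) f - real_mult (p (Suc k)) f" for k f
    by (auto simp: real_mult_def p_def q_def fun_eq_iff algebra_simps)
  have q: "real_mult (q k) f \<in> C0 X" if "f \<in> C0 X" for k f
    unfolding q_eq using p that by (intro C0_diff)
  let ?p = "\<lambda>k. real_mult (p k)" and ?q = "\<lambda>k. real_mult (q k)"
  have 1: "B (?p (Suc (Suc k)) b) (c - ?p (Suc k) c) = 0"
  proof (rule orthogonal)
    show "?p (Suc (Suc k)) b * (c - ?p (Suc k) c) = 0"
      using ramp_Suc_cases[of y "Suc k"] by (force simp: fun_eq_iff real_mult_def p_def)
  qed (simp_all add: p b c C0_diff)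
  have 2: "B (?q (Suc k) b) (c - ?p k c) = 0"
  proof (rule orthogonal)
    show "?q (Suc k) b * (c - ?p k c) = 0"
    proof
      fix x
      \<comment> \<open>If \<open>p (Suc k)\<close> is 0 at \<open>x\<close>, so is the smaller
        \<open>p (Suc (Suc k))\<close>; otherwise \<open>p k\<close> is 1 there.\<close>
      have "q (Suc k) x = 0 \<or> p k x = 1"
        using ramp_Suc_cases[of y k x] ramp_Suc_le[of y "Suc k" x] ramp_bounds[of y "Suc (Suc k)" x]
        by (auto simp: q_def p_def)
      then show "(?q (Suc k) b * (c - ?p k c)) x = 0 x"
        by (auto simp: real_mult_def)
    qed
  qed (simp_all add: p q b c C0_diff)
  have "B (?p (Suc k) b) (c - ?p (Suc k) c)
      = B (?q (Suc k) b + ?p (Suc (Suc k)) b) (c - ?p (Suc k) c)"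
    by (simp add: q_eq)
  also have "\<dots> = B (?q (Suc k) b) (c - ?p (Suc k) c)"
    using 1 p q b c by (simp add: add_left C0_diff)
  also have "\<dots> = B (?q (Suc k) b) ((c - ?p k c) + ?q k c)"
    by (simp add: q_eq)
  also have "\<dots> = B (?q (Suc k) b) (?q k c)"
    using 2 p q b c by (simp add: add_right C0_diff)
  finally show ?thesis .
qed

text \<open>The differences \<open>q\<close> are nonnegative and telescope to at most 1 at each
  point, so \<open>diagonal_sum_bound\<close> applies with the norms of \<open>b\<close> and
  \<open>c\<close>, uniformly in \<open>n\<close> and \<open>y\<close>.\<close>

lemma ramp_sum_bound:
  fixes y :: "'a \<Rightarrow> real"
  assumes y: "continuous_map X euclidean y" and b: "b \<in> C0 X" and c: "c \<in> C0 X"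
  shows "cmod (\<Sum>k<n. B (real_mult (ramp y (Suc k)) b) (c - real_mult (ramp y (Suc k)) c))
    \<le> K * C0_norm b * C0_norm c"
proof -
  define q where "q k x = ramp y k x - ramp y (Suc k) x" for k and x :: 'a
  have q_nonneg: "0 \<le> q k x" and q_le: "q k x \<le> 1" for k x
    using ramp_Suc_le[of y k x] ramp_bounds[of y k x] ramp_bounds[of y "Suc k" x]
    by (auto simp: q_def)
  have qC: "real_mult (q k) f \<in> C0 X" if "f \<in> C0 X" for k f
  proof (rule C0_real_mult[OF that, where M = 1])
    show "continuous_map X euclidean (q k)"
      unfolding q_def[abs_def] using y by (intro continuous_map_diff continuous_map_ramp)
    show "\<bar>q k x\<bar> \<le> 1" for x
      using q_nonneg[of k x] q_le[of k x] by simp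
  qed
  \<comment> \<open>The shift \<open>j\<close> serves both families: \<open>j = 1\<close> for the
    factors of \<open>b\<close> and \<open>j = 0\<close> for those of \<open>c\<close>.\<close>
  have sum_q: "(\<Sum>k<n. q (k + j) x) \<le> 1" for j x
  proof -
    have "(\<Sum>k<n. q (k + j) x) = ramp y j x - ramp y (n + j) x"
      unfolding q_def by (induction n) auto
    then show ?thesis
      using ramp_bounds[of y j x] ramp_bounds[of y "n + j" x] by simp
  qed
  have norm_q: "(\<Sum>k<n. cmod (real_mult (q (k + j)) f x)) \<le> C0_norm f" if f: "f \<in> C0 X" for j f x
  proof -
    have "(\<Sum>k<n. cmod (real_mult (q (k + j)) f x)) = (\<Sum>k<n. q (k + j) x) * cmod (f x)"
      using q_nonneg by (simp add: real_mult_def norm_mult sum_distrib_right)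
    also have "\<dots> \<le> 1 * C0_norm f"
      using sum_q[of j x] C0_norm_upper[OF f, of x] q_nonneg by (intro mult_mono) (auto intro: sum_nonneg)
    finally show ?thesis by simp
  qed
  have B0: "B 0 0 = 0"
    by (intro orthogonal C0_zero) simp
  have "cmod (B 0 0 + (\<Sum>k<n. B (real_mult (q (Suc k)) b) (real_mult (q k) c)))
      \<le> K * C0_norm b * C0_norm c"
    using norm_q[OF b, where j = 1] norm_q[OF c, where j = 0]
    by (intro diagonal_sum_bound) (auto simp: C0_zero qC b c)
  moreover have "B (real_mult (ramp y (Suc k)) b) (c - real_mult (ramp y (Suc k)) c)
      = B (real_mult (q (Suc k)) b) (real_mult (q k) c)" for k
    unfolding q_def[abs_def] using ramp_strip[OF y b c] .
  ultimately show ?thesis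
    using B0 by simp
qed

text \<open>The height \<open>M\<close> of \<open>y\<close> only decides how many ramps are summed,
  and the bound on such sums does not depend on their number.\<close>

lemma balanced_defect_bound:
  fixes y :: "'a \<Rightarrow> real"
  assumes y: "continuous_map X euclidean y" "\<And>x. 0 \<le> y x" "\<And>x. y x \<le> M"
    and b: "b \<in> C0 X" and c: "c \<in> C0 X"
  shows "cmod (B (real_mult y b) c - B b (real_mult y c)) \<le> 2 * (K * C0_norm b * C0_norm c)"
proof -
  interpret flip: C0_orthogonal_form X "\<lambda>u v. B v u" K
    by (rule flip)
  obtain n where "M \<le> real n"
    using real_arch_simple by blast
  then have yn: "y x \<le> real n" for x
    using y(3) order_trans by blast
  let ?p = "\<lambda>k. real_mult (ramp y (Suc k))"
  have p: "?p k f \<in> C0 X" if "f \<in> C0 X" for k f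
    using that y(1) ramp_bounds[of y "Suc k"]
    by (intro C0_real_mult[where M = 1]) (auto intro: continuous_map_ramp)
  have y_sum: "real_mult y f = (\<Sum>k<n. ?p k f)" for f
  proof
    fix x
    have "real_mult y f x = complex_of_real (\<Sum>k<n. ramp y (Suc k) x) * f x"
      using sum_ramp[of y x n, OF y(2) yn] by (simp add: real_mult_def)
    then show "real_mult y f x = (\<Sum>k<n. ?p k f) x"
      by (simp add: sum_fun_apply real_mult_def sum_distrib_right)
  qed
  \<comment> \<open>The term \<open>B (?p k b) (?p k c)\<close> is subtracted and added back. The
    first resulting sum is bounded directly, the second through the flipped form.\<close>
  have summand: "B (?p k b) c - B b (?p k c) = B (?p k b) (c - ?p k c) - B (b - ?p k b) (?p k c)" for k
    using p b c by (simp add: diff_left diff_right)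
  have "B (real_mult y b) c - B b (real_mult y c) = (\<Sum>k<n. B (?p k b) c - B b (?p k c))"
    using p b c unfolding y_sum by (simp add: sum_left flip.sum_left sum_subtractf)
  also have "\<dots> = (\<Sum>k<n. B (?p k b) (c - ?p k c)) - (\<Sum>k<n. B (b - ?p k b) (?p k c))"
    by (simp only: summand sum_subtractf)
  also have "cmod \<dots> \<le> K * C0_norm b * C0_norm c + K * C0_norm c * C0_norm b"
    using ramp_sum_bound[OF y(1) b c] flip.ramp_sum_bound[OF y(1) c b]
    by (rule order_trans[OF norm_triangle_ineq4 add_mono])
  finally show ?thesis
    by (simp add: mult.commute mult.left_commute)
qed

text \<open>Replacing \<open>y\<close> by \<open>N\<close> times \<open>y\<close> multiplies the
  defect by \<open>N\<close> while its bound stays fixed, so the defect is 0.\<close>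

lemma balanced_nonneg:
  fixes y :: "'a \<Rightarrow> real"
  assumes y: "continuous_map X euclidean y" "\<And>x. 0 \<le> y x" "\<And>x. y x \<le> M"
    and b: "b \<in> C0 X" and c: "c \<in> C0 X"
  shows "B (real_mult y b) c = B b (real_mult y c)"
proof -
  define D where "D = B (real_mult y b) c - B b (real_mult y c)"
  define C where "C = 2 * (K * C0_norm b * C0_norm c)"
  have yC: "real_mult y f \<in> C0 X" if "f \<in> C0 X" for f
    using y that by (intro C0_real_mult[where M = M]) auto
  have "real N * cmod D \<le> C" for N :: nat
  proof -
    have eq: "real_mult (\<lambda>x. real N * y x) f = C0_scale (of_nat N) (real_mult y f)" for f
      by (simp add: real_mult_def C0_scale_def fun_eq_iff)
    have "cmod (B (real_mult (\<lambda>x. real N * y x) b) c - B b (real_mult (\<lambda>x. real N * y x) c)) \<le> C"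
      unfolding C_def
    proof (rule balanced_defect_bound[where M = "real N * M"])
      show "continuous_map X euclidean (\<lambda>x. real N * y x)"
        using y by (intro continuous_map_real_mult) auto
    qed (use y b c in \<open>auto intro: mult_left_mono\<close>)
    also have "B (real_mult (\<lambda>x. real N * y x) b) c - B b (real_mult (\<lambda>x. real N * y x) c) = of_nat N * D"
      unfolding eq using yC b c by (simp add: D_def scale_left scale_right algebra_simps)
    finally show ?thesis
      by (simp add: norm_mult)
  qed
  then have "D = 0"
    by (metis ex_less_of_nat_mult leD zero_less_norm_iff)
  then show ?thesis
    by (simp add: D_def)
qed

text \<open>By linearity it is enough to treat the positive and negative parts of the real and
  imaginary parts of \<open>a\<close>.\<close>

lemma balanced:
  assumes a: "a \<in> C0 X" and b: "b \<in> C0 X" and c: "c \<in> C0 X"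
  shows "B (a * b) c = B b (a * c)"
proof -
  obtain M where M: "\<And>x. cmod (a x) \<le> M"
    using C0_bounded[OF a] by blast
  \<comment> \<open>One argument covers the four parts, with \<open>g\<close> being
    \<open>Re\<close>, \<open>Im\<close> or their negatives: domination by \<open>cmod\<close> keeps
    \<open>max 0 (g (a x))\<close> between 0 and \<open>M\<close>.\<close>
  have parts: "B (real_mult (\<lambda>x. max 0 (g (a x))) b) c = B b (real_mult (\<lambda>x. max 0 (g (a x))) c)"
      "real_mult (\<lambda>x. max 0 (g (a x))) b \<in> C0 X" "real_mult (\<lambda>x. max 0 (g (a x))) c \<in> C0 X"
    if g: "continuous_on UNIV g" "\<And>z. g z \<le> cmod z" for g
  proof -
    have cont: "continuous_map X euclidean (\<lambda>x. max 0 (g (a x)))"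
      by (rule continuous_map_continuous_on_compose[where S = UNIV and f = a])
        (use g C0_continuous[OF a] in \<open>auto intro!: continuous_intros\<close>)
    have le: "max 0 (g (a x)) \<le> M" for x
      using g(2)[of "a x"] M[of x] norm_ge_zero[of "a x"] by linarith
    show "B (real_mult (\<lambda>x. max 0 (g (a x))) b) c = B b (real_mult (\<lambda>x. max 0 (g (a x))) c)"
      using cont le b c by (intro balanced_nonneg[where M = M]) auto
    show "real_mult (\<lambda>x. max 0 (g (a x))) b \<in> C0 X" "real_mult (\<lambda>x. max 0 (g (a x))) c \<in> C0 X"
      using cont le b c by (auto intro!: C0_real_mult[where M = M])
  qed
  have le: "Re z \<le> cmod z" "- Re z \<le> cmod z" "Im z \<le> cmod z" "- Im z \<le> cmod z" for z
    using abs_Re_le_cmod[of z] abs_Im_le_cmod[of z] by linarith+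
  have cont: "continuous_on UNIV Re" "continuous_on UNIV (\<lambda>z. - Re z)"
    "continuous_on UNIV Im" "continuous_on UNIV (\<lambda>z. - Im z)"
    by (intro continuous_intros)+
  let ?r = "\<lambda>g. real_mult (\<lambda>x. max 0 (g (a x)))"
  note p = parts[OF cont(1) le(1)] parts[OF cont(2) le(2)] parts[OF cont(3) le(3)]
    parts[OF cont(4) le(4)]
  have decomp: "a * f = (?r Re f - ?r (\<lambda>z. - Re z) f) + C0_scale \<i> (?r Im f - ?r (\<lambda>z. - Im z) f)" for f
  proof
    fix x
    have "a x = complex_of_real (max 0 (Re (a x)) - max 0 (- Re (a x)))
        + \<i> * complex_of_real (max 0 (Im (a x)) - max 0 (- Im (a x)))"
      by (simp add: complex_eq_iff max_def)
    then have "a x * f x = (complex_of_real (max 0 (Re (a x)) - max 0 (- Re (a x)))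
        + \<i> * complex_of_real (max 0 (Im (a x)) - max 0 (- Im (a x)))) * f x"
      by (rule arg_cong)
    then show "(a * f) x
        = ((?r Re f - ?r (\<lambda>z. - Re z) f) + C0_scale \<i> (?r Im f - ?r (\<lambda>z. - Im z) f)) x"
      by (simp add: real_mult_def C0_scale_def algebra_simps)
  qed
  show ?thesis
    unfolding decomp using p b c
    by (simp add: add_left add_right diff_left diff_right scale_left scale_right
        C0_diff C0_scale_mem)
qed

end

section \<open>From balanced forms to multipliers\<close>

theorem theorem4p1:
  fixes X :: "'a topology"
  assumes "locally_compact_space X"
  shows "hyper_Tauberian C0_scale (C0 X) C0_norm"
proof -
  interpret comm_banach_algebra C0_scale "C0 X" C0_norm
    by (rule C0_comm_banach_algebra)
  show ?thesis
  proof (unfold_locales)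
    show semisimple
      by (rule C0_semisimple)
    show regular
      by (rule C0_regular)
    fix T :: "('a \<Rightarrow> complex) \<Rightarrow> ('a \<Rightarrow> complex) \<Rightarrow> complex"
    assume T: "bounded_operator_to_dual T" "local_map (C0 X) (*) dual_act T"
    obtain K where K: "K \<ge> 0"
      "\<And>a b. a \<in> C0 X \<Longrightarrow> b \<in> C0 X \<Longrightarrow> cmod (T a b) \<le> K * C0_norm a * C0_norm b"
      using bounded_operator_bilinear_bound[OF T(1)] by blast
    have T_dual: "linear_functional (T a)" if "a \<in> C0 X" for a
      using T(1) that by (auto simp: bounded_operator_to_dual_def dual_def)
    interpret C0_orthogonal_form X T K
    proof
      fix u v w c
      assume "u \<in> C0 X" "w \<in> C0 X"
      then show "T (C0_scale c u) w = c * T u w" "T w (C0_scale c u) = c * T w u"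
        using T(1) T_dual by (auto simp: bounded_operator_to_dual_def linear_functional_def)
      assume "v \<in> C0 X"
      with \<open>u \<in> C0 X\<close> \<open>w \<in> C0 X\<close> show "T (u + v) w = T u w + T v w" "T w (u + v) = T w u + T w v"
        using T(1) T_dual by (auto simp: bounded_operator_to_dual_def linear_functional_def)
    qed (use K local_map_disjoint[OF T] in auto)
    show "multiplier_to_dual T"
      unfolding multiplier_to_dual_def
    proof (intro ballI ext)
      fix a b c
      assume ab: "a \<in> C0 X" "b \<in> C0 X"
      show "T (a * b) c = dual_act a (T b) c"
      \<comment> \<open>For \<open>c\<close> in the algebra the claim is
        \<open>T (a * b) c = T b (c * a)\<close>, which is \<open>balanced\<close> up to
        commutativity. Off the algebra both sides are 0 by convention.\<close>
      proof (cases "c \<in> C0 X")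
        case True
        then show ?thesis
          using balanced[OF ab] by (simp add: dual_act_def mult.commute)
      next
        case False
        then show ?thesis
          using T_dual[OF C0_mult[OF ab]] by (simp add: dual_act_def linear_functional_def)
      qed
    qed
  qed
qed

end
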